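(* There is a deterministic (polynomial time) online fractional algorithm that maintains the condition that for every request time $t$, there exists an index $j \in [\ell]$ such that there is unit server mass of weight $W_j$ at location $\sigma_t$ at time $t$. The algorithm uses $2\ell k_j$ servers of weight $W_j$ for each $j \in [\ell]$, and its cost is at most $O(\ell^2 \log \ell)$ times that of an optimal fractional solution.
   Context: Weighted $k$-server problem on the uniform metric: $n$ points $V$ with all pairwise distances $1$; there are $\ell$ distinct server weights $W_1,\dots,W_\ell$ with $k_j$ servers of weight $W_j$; requests $\sigma_1,\dots,\sigma_T \in V$ arrive online, and moving a server of weight $W_j$ between distinct points costs $W_j$. A fractional solution specifies $x_{v,j,t}\ge 0$, the fractional mass of servers of weight $W_j$ at location $v$ at time $t$; the natural LP relaxation minimizes $\tfrac12\sum_{j} W_j \sum_t \sum_{v} |x_{v,j,t}-x_{v,j,t-1}|$ subject to $\sum_{v} x_{v,j,t}\le k_j$ for all $t,j$ and $\sum_j x_{\sigma_t,j,t}\ge 1$ for all $t$. An optimal fractional solution is an optimal solution to this LP (with the original server counts $k_j$). Note the condition in the claim (a single weight class supplying a full unit of mass at $\sigma_t$) is stronger than the LP covering constraint $\sum_j x_{\sigma_t,j,t}\ge 1$. *)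

theory Defs
  imports Complex_Main "HOL-Library.Landau_Symbols"
begin

section \<open>Weighted \<open>k\<close>-server on the uniform metric\<close>

text \<open>
  Points are \<open>0, \<dots>, num_points - 1\<close> and weight classes are \<open>0, \<dots>, num_weights - 1\<close>;
  \<open>init v j\<close> is the number of servers of weight class \<open>j\<close> standing at point \<open>v\<close> before the
  first request. Servers that are not placed by \<open>init\<close> start outside of the space; in
  particular \<open>init\<close> may be identically zero.
\<close>

record server_instance =
  num_points :: nat
  num_weights :: nat
  servers :: "nat \<Rightarrow> nat"
  weight :: "nat \<Rightarrow> real"
  init :: "nat \<Rightarrow> nat \<Rightarrow> nat"

definition valid_instance :: "server_instance \<Rightarrow> bool" where
  "valid_instance I \<longleftrightarrow>
     num_points I \<ge> 1 \<and> num_weights I \<ge> 1 \<and>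
     (\<forall>j<num_weights I. weight I j > 0) \<and>
     inj_on (weight I) {..<num_weights I} \<and>
     (\<forall>j<num_weights I. servers I j \<ge> 1) \<and>
     (\<forall>j<num_weights I. (\<Sum>v<num_points I. init I v j) \<le> servers I j)"

definition valid_requests :: "server_instance \<Rightarrow> nat list \<Rightarrow> bool" where
  "valid_requests I \<sigma> \<longleftrightarrow> set \<sigma> \<subseteq> {..<num_points I}"

text \<open>
  A fractional solution is a function \<open>x\<close> where \<open>x v j t\<close> is the mass of servers of weight
  class \<open>j\<close> at point \<open>v\<close> at time \<open>t\<close>. Times range over \<open>0, \<dots>, T\<close>, time \<open>0\<close> being the
  initial configuration; the request of time \<open>t \<ge> 1\<close> is \<open>\<sigma> ! (t - 1)\<close>.
\<close>

definition fractional_solution ::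
    "server_instance \<Rightarrow> (nat \<Rightarrow> nat) \<Rightarrow> nat \<Rightarrow> (nat \<Rightarrow> nat \<Rightarrow> nat \<Rightarrow> real) \<Rightarrow> bool" where
  "fractional_solution I cap T x \<longleftrightarrow>
     (\<forall>v<num_points I. \<forall>j<num_weights I. x v j 0 = real (init I v j)) \<and>
     (\<forall>v<num_points I. \<forall>j<num_weights I. \<forall>t\<le>T. x v j t \<ge> 0) \<and>
     (\<forall>j<num_weights I. \<forall>t\<le>T. (\<Sum>v<num_points I. x v j t) \<le> real (cap j))"

definition movement_cost ::
    "server_instance \<Rightarrow> nat \<Rightarrow> (nat \<Rightarrow> nat \<Rightarrow> nat \<Rightarrow> real) \<Rightarrow> real" where
  "movement_cost I T x =
     1/2 * (\<Sum>j<num_weights I. weight I j *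
              (\<Sum>t=1..T. \<Sum>v<num_points I. \<bar>x v j t - x v j (t - 1)\<bar>))"

definition lp_feasible ::
    "server_instance \<Rightarrow> nat list \<Rightarrow> (nat \<Rightarrow> nat \<Rightarrow> nat \<Rightarrow> real) \<Rightarrow> bool" where
  "lp_feasible I \<sigma> x \<longleftrightarrow>
     fractional_solution I (servers I) (length \<sigma>) x \<and>
     (\<forall>t\<in>{1..length \<sigma>}. (\<Sum>j<num_weights I. x (\<sigma> ! (t - 1)) j t) \<ge> 1)"

definition lp_opt :: "server_instance \<Rightarrow> nat list \<Rightarrow> real" where
  "lp_opt I \<sigma> = Inf (movement_cost I (length \<sigma>) ` {x. lp_feasible I \<sigma> x})"

text \<open>
  A deterministic online fractional algorithm maps an instance and the requests seen so far to
  the current configuration; \<open>trajectory A I \<sigma>\<close> is the fractional solution it produces.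
\<close>

type_synonym online_alg = "server_instance \<Rightarrow> nat list \<Rightarrow> nat \<Rightarrow> nat \<Rightarrow> real"

definition trajectory ::
    "online_alg \<Rightarrow> server_instance \<Rightarrow> nat list \<Rightarrow> nat \<Rightarrow> nat \<Rightarrow> nat \<Rightarrow> real" where
  "trajectory A I \<sigma> v j t = A I (take t \<sigma>) v j"

definition single_weight_service ::
    "server_instance \<Rightarrow> nat list \<Rightarrow> (nat \<Rightarrow> nat \<Rightarrow> nat \<Rightarrow> real) \<Rightarrow> bool" where
  "single_weight_service I \<sigma> x \<longleftrightarrow>
     (\<forall>t\<in>{1..length \<sigma>}. \<exists>j<num_weights I. x (\<sigma> ! (t - 1)) j t \<ge> 1)"


section \<open>Polynomial time\<close>

text \<open>
  Weights are real numbers, so the machine model is a real RAM (uniform, unit cost): programs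
  act on arrays of natural numbers and arrays of reals with indirect addressing. There is no
  rounding operation, indices admit only addition and truncated subtraction, and the only
  constants are integers, so that real constants cannot carry precomputed information.
  An expression is evaluated in one step, which is harmless because the expressions of a fixed
  program have bounded size.
\<close>

type_synonym ram_state = "(nat \<Rightarrow> nat \<Rightarrow> nat) \<times> (nat \<Rightarrow> nat \<Rightarrow> real)"

datatype nexp =
    NConst nat
  | NCell nat nexp
  | NAdd nexp nexp
  | NSub nexp nexp

datatype rexp =
    RConst int
  | RNat nexp
  | RCell nat nexp
  | RAdd rexp rexp
  | RSub rexp rexp
  | RMul rexp rexp
  | RDiv rexp rexp

datatype bexp =
    NLess nexp nexp
  | RLess rexp rexp
  | BNot bexp
  | BAnd bexp bexp

datatype com =
    Skip
  | NAssign nat nexp nexp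
  | RAssign nat nexp rexp
  | Seq com com
  | Cond bexp com com
  | While bexp com

primrec nval :: "nexp \<Rightarrow> ram_state \<Rightarrow> nat" where
  "nval (NConst c) s = c"
| "nval (NCell a e) s = fst s a (nval e s)"
| "nval (NAdd e f) s = nval e s + nval f s"
| "nval (NSub e f) s = nval e s - nval f s"

primrec rval :: "rexp \<Rightarrow> ram_state \<Rightarrow> real" where
  "rval (RConst c) s = of_int c"
| "rval (RNat e) s = real (nval e s)"
| "rval (RCell a e) s = snd s a (nval e s)"
| "rval (RAdd e f) s = rval e s + rval f s"
| "rval (RSub e f) s = rval e s - rval f s"
| "rval (RMul e f) s = rval e s * rval f s"
| "rval (RDiv e f) s = rval e s / rval f s"

primrec bval :: "bexp \<Rightarrow> ram_state \<Rightarrow> bool" where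
  "bval (NLess e f) s \<longleftrightarrow> nval e s < nval f s"
| "bval (RLess e f) s \<longleftrightarrow> rval e s < rval f s"
| "bval (BNot b) s \<longleftrightarrow> \<not> bval b s"
| "bval (BAnd b c) s \<longleftrightarrow> bval b s \<and> bval c s"

definition upd :: "(nat \<Rightarrow> nat \<Rightarrow> 'a) \<Rightarrow> nat \<Rightarrow> nat \<Rightarrow> 'a \<Rightarrow> nat \<Rightarrow> nat \<Rightarrow> 'a" where
  "upd m a i y = m(a := (m a)(i := y))"

text \<open>\<open>runs c s t s'\<close>: started in \<open>s\<close>, program \<open>c\<close> halts in \<open>s'\<close> after \<open>t\<close> steps.\<close>

inductive runs :: "com \<Rightarrow> ram_state \<Rightarrow> nat \<Rightarrow> ram_state \<Rightarrow> bool" where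
  Skip: "runs Skip s 1 s"
| NAssign: "runs (NAssign a i e) s 1 (upd (fst s) a (nval i s) (nval e s), snd s)"
| RAssign: "runs (RAssign a i e) s 1 (fst s, upd (snd s) a (nval i s) (rval e s))"
| Seq: "runs c1 s1 t1 s2 \<Longrightarrow> runs c2 s2 t2 s3 \<Longrightarrow> runs (Seq c1 c2) s1 (t1 + t2) s3"
| CondTrue: "bval b s \<Longrightarrow> runs c1 s t s' \<Longrightarrow> runs (Cond b c1 c2) s (t + 1) s'"
| CondFalse: "\<not> bval b s \<Longrightarrow> runs c2 s t s' \<Longrightarrow> runs (Cond b c1 c2) s (t + 1) s'"
| WhileFalse: "\<not> bval b s \<Longrightarrow> runs (While b c) s 1 s"
| WhileTrue: "bval b s1 \<Longrightarrow> runs c s1 t1 s2 \<Longrightarrow> runs (While b c) s2 t2 s3 \<Longrightarrow>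
    runs (While b c) s1 (t1 + t2 + 1) s3"

text \<open>
  Input layout: natural number array 0 holds the number of points, of weights and of requests,
  array 1 the requests, array 2 the server counts and array 3 the initial configuration
  (row-major, entry \<open>(v, j)\<close> at \<open>v * num_weights + j\<close>); real array 0 holds the weights. All
  other cells are 0.
\<close>

definition input_state :: "server_instance \<Rightarrow> nat list \<Rightarrow> ram_state" where
  "input_state I \<sigma> =
    ((\<lambda>a i.
        if a = 0 \<and> i = 0 then num_points I
        else if a = 0 \<and> i = 1 then num_weights I
        else if a = 0 \<and> i = 2 then length \<sigma>
        else if a = 1 \<and> i < length \<sigma> then \<sigma> ! i
        else if a = 2 \<and> i < num_weights I then servers I i
        else if a = 3 \<and> i < num_points I * num_weights I
          then init I (i div num_weights I) (i mod num_weights I)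
        else 0),
     (\<lambda>a i. if a = 0 \<and> i < num_weights I then weight I i else 0))"

definition ram_output :: "server_instance \<Rightarrow> ram_state \<Rightarrow> nat \<Rightarrow> nat \<Rightarrow> real" where
  "ram_output I s v j = snd s 1 (v * num_weights I + j)"

text \<open>
  One program, for all instances, computes the configuration after the requests \<open>\<sigma>\<close>. Since the
  machine recomputes from the whole prefix, no state has to be carried over between requests;
  processing \<open>T\<close> requests costs the sum of the bounds for the \<open>T\<close> prefixes.
\<close>

definition polynomial_time :: "online_alg \<Rightarrow> bool" where
  "polynomial_time A \<longleftrightarrow>
     (\<exists>c d. \<forall>I \<sigma>. valid_instance I \<longrightarrow> valid_requests I \<sigma> \<longrightarrow>
        (\<exists>t s. runs c (input_state I \<sigma>) t s \<and>
               t \<le> d * (num_points I + num_weights I + length \<sigma>) ^ d \<and>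
               (\<forall>v<num_points I. \<forall>j<num_weights I. A I \<sigma> v j = ram_output I s v j)))"

end

theory Submission
  imports Defs
begin

text \<open>
  A request \<open>r\<close> raises all classes at \<open>r\<close> at rates inversely proportional to their weights until
  one of them reaches a unit of mass, so that every class pays the same amount \<open>s\<close>. A class whose
  total mass then exceeds \<open>2 l k\<^sub>j\<close> is scaled down proportionally at all other points.
  Against a feasible fractional solution \<open>y\<close> consider the potential
  \<open>\<Sum>\<^sub>j W\<^sub>j \<Sum>\<^sub>v y\<^sub>v\<^sub>j max 0 (1 - x\<^sub>v\<^sub>j)\<close>. Raising lowers it by \<open>s \<Sum>\<^sub>j y\<^sub>r\<^sub>j \<ge> s\<close>. Scaling class \<open>j\<close> removes
  at most \<open>s / W\<^sub>j\<close> out of at least \<open>2 l k\<^sub>j - 1\<close> units of mass, and \<open>y\<close> has at most \<open>k\<^sub>j\<close> units in this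
  class, so all classes together raise the potential by at most \<open>2 s / 3\<close>. The algorithm moves at
  cost at most \<open>l s\<close>, while a move of \<open>y\<close> raises the potential by at most twice its cost. This
  gives the ratio \<open>6 l\<close>, which is better than \<open>l\<^sup>2 ln l\<close>.
\<close>

section \<open>The algorithm and its competitive ratio\<close>

definition raise_level :: "server_instance \<Rightarrow> (nat \<Rightarrow> nat \<Rightarrow> real) \<Rightarrow> nat \<Rightarrow> real" where
  "raise_level I x r = max 0 (Min ((\<lambda>j. weight I j * (1 - x r j)) ` {..<num_weights I}))"

definition raised :: "server_instance \<Rightarrow> (nat \<Rightarrow> nat \<Rightarrow> real) \<Rightarrow> nat \<Rightarrow> nat \<Rightarrow> real" where
  "raised I x r j = x r j + raise_level I x r / weight I j"

definition load :: "server_instance \<Rightarrow> (nat \<Rightarrow> nat \<Rightarrow> real) \<Rightarrow> nat \<Rightarrow> nat \<Rightarrow> real" where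
  "load I x r j = (\<Sum>u<num_points I. if u = r then raised I x r j else x u j)"

definition capacity :: "server_instance \<Rightarrow> nat \<Rightarrow> real" where
  "capacity I j = 2 * real (num_weights I) * real (servers I j)"

text \<open>In the overflow case the denominator is the mass off \<open>r\<close> and the numerator
  is the room that the raised mass leaves for it, so the scaled class has total mass exactly
  \<open>capacity I j\<close>.\<close>

definition serve ::
    "server_instance \<Rightarrow> (nat \<Rightarrow> nat \<Rightarrow> real) \<Rightarrow> nat \<Rightarrow> nat \<Rightarrow> nat \<Rightarrow> real" where
  "serve I x r v j =
     (if v = r then raised I x r j
      else if capacity I j < load I x r j
        then x v j * ((capacity I j - raised I x r j) / (load I x r j - raised I x r j))
      else x v j)"

definition serve_all :: online_alg where
  "serve_all I \<sigma> = foldl (serve I) (\<lambda>v j. real (init I v j)) \<sigma>"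

definition configuration :: "server_instance \<Rightarrow> (nat \<Rightarrow> nat \<Rightarrow> real) \<Rightarrow> bool" where
  "configuration I x \<longleftrightarrow>
     (\<forall>v<num_points I. \<forall>j<num_weights I. 0 \<le> x v j) \<and>
     (\<forall>j<num_weights I. (\<Sum>v<num_points I. x v j) \<le> capacity I j)"

definition gap :: "real \<Rightarrow> real" where
  "gap a = max 0 (1 - a)"

definition potential ::
    "server_instance \<Rightarrow> (nat \<Rightarrow> nat \<Rightarrow> real) \<Rightarrow> (nat \<Rightarrow> nat \<Rightarrow> real) \<Rightarrow> real" where
  "potential I y x =
     (\<Sum>j<num_weights I. weight I j * (\<Sum>v<num_points I. y v j * gap (x v j)))"

text \<open>Departures and arrivals both count and there is no factor 1/2, so this is twice the cost
  of a move. The halving returns only in \<open>movement_cost_eq_distance\<close>.\<close>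

definition distance ::
    "server_instance \<Rightarrow> (nat \<Rightarrow> nat \<Rightarrow> real) \<Rightarrow> (nat \<Rightarrow> nat \<Rightarrow> real) \<Rightarrow> real" where
  "distance I x x' =
     (\<Sum>j<num_weights I. weight I j * (\<Sum>v<num_points I. \<bar>x' v j - x v j\<bar>))"

section \<open>Elementary bounds on the raise, the capacity and the gap\<close>

lemma raise_level_nonneg: "0 \<le> raise_level I x r"
  by (simp add: raise_level_def)

lemma raise_level_attained:
  assumes "0 < num_weights I"
  obtains j where "j < num_weights I" "weight I j * (1 - x r j) \<le> raise_level I x r"
proof -
  let ?M = "(\<lambda>j. weight I j * (1 - x r j)) ` {..<num_weights I}"
  have "Min ?M \<in> ?M"
    using assms by (intro Min_in) auto
  then obtain j where "j < num_weights I" "weight I j * (1 - x r j) = Min ?M"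
    by auto
  then show ?thesis
    using that by (simp add: raise_level_def)
qed

text \<open>A positive level is not clipped by the \<open>max\<close>, hence is the minimum itself,
  and no class gets past a unit. At level 0 the mass at \<open>r\<close> may already exceed 1, for
  example through several initial servers there.\<close>

lemma raised_le_1:
  assumes "j < num_weights I" "0 < weight I j" "0 < raise_level I x r"
  shows "raised I x r j \<le> 1"
proof -
  have "raise_level I x r = Min ((\<lambda>j. weight I j * (1 - x r j)) ` {..<num_weights I})"
    using assms(3) by (auto simp: raise_level_def max_def split: if_splits)
  also have "\<dots> \<le> weight I j * (1 - x r j)"
    using assms(1) by (intro Min_le) auto
  finally show ?thesis
    using assms(2) by (simp add: raised_def field_simps)
qed

lemma capacity_ge_2:
  assumes "valid_instance I" "j < num_weights I"
  shows "2 \<le> capacity I j"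
proof -
  have "1 \<le> num_weights I" "1 \<le> servers I j"
    using assms by (auto simp: valid_instance_def)
  then have "1 * 1 \<le> num_weights I * servers I j"
    by (intro mult_le_mono)
  then have "1 \<le> real (num_weights I * servers I j)"
    by linarith
  then show ?thesis
    by (simp add: capacity_def)
qed

text \<open>For \<open>a \<le> 1\<close> the gap grows by
  \<open>a * \<theta> \<le> \<theta>\<close>. For \<open>a > 1\<close> it starts at 0 and
  \<open>a * (1 - \<theta>)\<close> stays above \<open>1 - \<theta>\<close>, so evicting from a
  large mass is no worse than evicting from a unit.\<close>

lemma gap_scale:
  assumes "0 \<le> \<theta>" "\<theta> \<le> 1" "0 \<le> a"
  shows "gap (a * (1 - \<theta>)) \<le> gap a + \<theta>"
proof (cases "a \<le> 1")
  case True
  then have "a * \<theta> \<le> 1 * \<theta>"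
    using assms by (intro mult_right_mono)
  then show ?thesis
    using True assms by (simp add: gap_def algebra_simps)
next
  case False
  then have "1 * (1 - \<theta>) \<le> a * (1 - \<theta>)"
    using assms by (intro mult_right_mono) auto
  then show ?thesis
    using False assms by (simp add: gap_def algebra_simps)
qed

lemma sum_split_at:
  fixes f :: "nat \<Rightarrow> real"
  assumes "r < n"
  shows "(\<Sum>u<n. f u) = f r + (\<Sum>u\<in>{..<n}-{r}. f u)"
  using assms by (simp add: sum.remove)

section \<open>Effect of one serving step on a single class\<close>

context
  fixes I x r j
  assumes valid: "valid_instance I" and conf: "configuration I x"
    and r: "r < num_points I" and j: "j < num_weights I"
begin

text \<open>Both branches of \<open>serve\<close> become scaling by \<open>1 - \<theta>\<close>,
  with \<open>\<theta> = 0\<close> if nothing overflows. The evicted mass is the overflow, which is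
  at most the raise; the bound with the mass off \<open>r\<close> controls the movement, the one
  with \<open>capacity I j - 1\<close> the potential.\<close>

lemma serve_scales:
  obtains \<theta> where "0 \<le> \<theta>" "\<theta> \<le> 1"
    "\<And>v. v \<noteq> r \<Longrightarrow> serve I x r v j = x v j * (1 - \<theta>)"
    "\<theta> * (\<Sum>u\<in>{..<num_points I}-{r}. x u j) \<le> raise_level I x r / weight I j"
    "\<theta> * (capacity I j - 1) \<le> raise_level I x r / weight I j"
    "(\<Sum>v<num_points I. serve I x r v j) \<le> capacity I j"
proof -
  let ?K = "capacity I j" and ?z = "raised I x r j" and ?L = "load I x r j"
  define M where "M = (\<Sum>u\<in>{..<num_points I}-{r}. x u j)"
  define a where "a = raise_level I x r / weight I j"
  have w: "0 < weight I j"
    using valid j by (simp add: valid_instance_def)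
  have a0: "0 \<le> a"
    using w raise_level_nonneg[of I x r] by (simp add: a_def)
  have L: "?L = ?z + M"
    using r by (simp add: load_def M_def sum_split_at)
  have z: "?z = x r j + a"
    by (simp add: raised_def a_def)
  have tot: "x r j + M \<le> ?K"
    using conf j r unfolding configuration_def M_def by (metis sum_split_at)
  show ?thesis
  proof (cases "?K < ?L")
    case False
    have "(\<Sum>v<num_points I. serve I x r v j) = ?L"
      using False by (auto simp: load_def serve_def intro!: sum.cong)
    then show ?thesis
      using False a0 by (intro that[of 0]) (auto simp: serve_def a_def)
  next
    case True
    \<comment> \<open>The mass before the request fits into the capacity, so an overflow forces a
      proper raise. This makes \<open>raised_le_1\<close> available, and at least
      \<open>?K - 1\<close> of the load must then lie off \<open>r\<close>.\<close>
    then have "0 < a"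
      using L z tot by linarith
    then have "0 < raise_level I x r"
      using w by (simp add: a_def zero_less_divide_iff)
    then have z1: "?z \<le> 1"
      using raised_le_1 j w by blast
    have K2: "2 \<le> ?K"
      using capacity_ge_2 valid j by blast
    have M1: "?K - 1 \<le> M" "0 < M"
      using True L z1 K2 by linarith+
    \<comment> \<open>The overflow as a fraction of the mass off \<open>r\<close>, from which alone
      it is evicted.\<close>
    define \<theta> where "\<theta> = (?L - ?K) / M"
    have \<theta>M: "\<theta> * M = ?L - ?K"
      using M1 by (simp add: \<theta>_def)
    have \<theta>0: "0 \<le> \<theta>"
      using True M1 by (simp add: \<theta>_def)
    have \<theta>1: "\<theta> \<le> 1"
      using L z1 K2 M1 by (simp add: \<theta>_def)
    have s: "serve I x r v j = x v j * (1 - \<theta>)" if "v \<noteq> r" for v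
    proof -
      have "(?K - ?z) / (?L - ?z) = 1 - \<theta>"
        using M1 L by (simp add: \<theta>_def field_simps)
      then show ?thesis
        using that True by (simp add: serve_def)
    qed
    have "(\<Sum>v<num_points I. serve I x r v j) = ?z + (\<Sum>v\<in>{..<num_points I}-{r}. x v j * (1 - \<theta>))"
      using r s by (subst sum_split_at[OF r]) (simp add: serve_def)
    also have "\<dots> = ?z + M * (1 - \<theta>)"
      by (simp add: M_def sum_distrib_right)
    also have "\<dots> = ?K"
      using \<theta>M L by (simp add: algebra_simps)
    finally have sum: "(\<Sum>v<num_points I. serve I x r v j) \<le> ?K"
      by simp
    have le: "\<theta> * M \<le> a"
      using \<theta>M L z tot by linarith
    have "\<theta> * (?K - 1) \<le> \<theta> * M"
      using \<theta>0 M1 by (intro mult_left_mono)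
    then show ?thesis
      using that[OF \<theta>0 \<theta>1 s] le sum by (simp add: M_def a_def)
  qed
qed

text \<open>The raise brings \<open>raise_level I x r / weight I j\<close> to \<open>r\<close>, and
  the scaling evicts at most as much elsewhere: hence the factor 2, independently of the
  weight.\<close>

lemma serve_movement_le:
  "weight I j * (\<Sum>v<num_points I. \<bar>serve I x r v j - x v j\<bar>) \<le> 2 * raise_level I x r"
proof -
  obtain \<theta> where \<theta>: "0 \<le> \<theta>"
    "\<And>v. v \<noteq> r \<Longrightarrow> serve I x r v j = x v j * (1 - \<theta>)"
    "\<theta> * (\<Sum>u\<in>{..<num_points I}-{r}. x u j) \<le> raise_level I x r / weight I j"
    using serve_scales by metis
  have w: "0 < weight I j"
    using valid j by (simp add: valid_instance_def)
  have "\<bar>serve I x r v j - x v j\<bar> = \<theta> * x v j" if "v \<in> {..<num_points I}-{r}" for v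
  proof -
    have "serve I x r v j - x v j = - (\<theta> * x v j)"
      using \<theta>(2) that by (simp add: algebra_simps)
    then show ?thesis
      using \<theta>(1) that conf j by (simp add: configuration_def)
  qed
  then have "(\<Sum>v<num_points I. \<bar>serve I x r v j - x v j\<bar>) =
      raise_level I x r / weight I j + \<theta> * (\<Sum>u\<in>{..<num_points I}-{r}. x u j)"
    using w raise_level_nonneg[of I x r]
    by (subst sum_split_at[OF r]) (simp add: serve_def raised_def sum_distrib_left)
  also have "\<dots> \<le> 2 * (raise_level I x r / weight I j)"
    using \<theta>(3) by simp
  finally have "weight I j * (\<Sum>v<num_points I. \<bar>serve I x r v j - x v j\<bar>)
      \<le> weight I j * (2 * (raise_level I x r / weight I j))"
    using w by (intro mult_left_mono) auto
  then show ?thesis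
    using w by simp
qed

text \<open>Here \<open>y\<close> is a single class of the reference solution. The gap at
  \<open>r\<close> shrinks by the raise, which gives the term \<open>- y r\<close>. Every other gap
  grows by at most \<open>\<theta>\<close>, weighted by at most \<open>servers I j - y r\<close>
  units of reference mass. The weight cancels, so that all classes share the factor
  \<open>raise_level I x r\<close>.\<close>

lemma serve_potential_le:
  assumes y0: "\<And>v. v < num_points I \<Longrightarrow> 0 \<le> y v"
    and yk: "(\<Sum>v<num_points I. y v) \<le> real (servers I j)"
  shows "weight I j * (\<Sum>v<num_points I. y v * gap (serve I x r v j))
    \<le> weight I j * (\<Sum>v<num_points I. y v * gap (x v j))
      + raise_level I x r * ((real (servers I j) - y r) / (capacity I j - 1) - y r)"
proof -
  let ?R = "{..<num_points I}-{r}" and ?K = "capacity I j"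
  define a where "a = raise_level I x r / weight I j"
  obtain \<theta> where \<theta>: "0 \<le> \<theta>" "\<theta> \<le> 1"
    "\<And>v. v \<noteq> r \<Longrightarrow> serve I x r v j = x v j * (1 - \<theta>)"
    "\<theta> * (?K - 1) \<le> a"
    using serve_scales unfolding a_def by metis
  have w: "0 < weight I j"
    using valid j by (simp add: valid_instance_def)
  have K: "0 < ?K - 1"
    using capacity_ge_2[OF valid j] by simp
  have yr: "(\<Sum>v\<in>?R. y v) \<le> real (servers I j) - y r"
    using yk sum_split_at[OF r, of y] by simp
  have yk0: "0 \<le> real (servers I j) - y r"
    by (rule order_trans[OF sum_nonneg yr]) (use y0 in auto)
  \<comment> \<open>The decrease is exact: if the level is positive, both the old and the raised
    mass are at most 1, where \<open>gap\<close> is linear.\<close>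
  have at_r: "gap (raised I x r j) = gap (x r j) - a"
  proof (cases "raise_level I x r = 0")
    case True
    then show ?thesis by (simp add: raised_def a_def)
  next
    case False
    then have p: "0 < raise_level I x r"
      using raise_level_nonneg[of I x r] by simp
    then have "raised I x r j \<le> 1"
      using raised_le_1 j w by blast
    moreover have "raised I x r j = x r j + a" "0 < a"
      using p w by (simp_all add: raised_def a_def)
    ultimately show ?thesis
      by (simp add: gap_def)
  qed
  have "(\<Sum>v\<in>?R. y v * gap (serve I x r v j)) \<le> (\<Sum>v\<in>?R. y v * (gap (x v j) + \<theta>))"
  proof (rule sum_mono)
    fix v assume v: "v \<in> ?R"
    then have "gap (x v j * (1 - \<theta>)) \<le> gap (x v j) + \<theta>"
      using \<theta> conf j by (intro gap_scale) (auto simp: configuration_def)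
    then show "y v * gap (serve I x r v j) \<le> y v * (gap (x v j) + \<theta>)"
      using v \<theta>(3) y0 by (auto intro!: mult_left_mono)
  qed
  also have "\<dots> = (\<Sum>v\<in>?R. y v * gap (x v j)) + \<theta> * (\<Sum>v\<in>?R. y v)"
    by (simp add: distrib_left sum.distrib sum_distrib_left mult.commute)
  also have "\<theta> * (\<Sum>v\<in>?R. y v) \<le> a / (?K - 1) * (real (servers I j) - y r)"
  proof (rule mult_mono)
    show "\<theta> \<le> a / (?K - 1)"
      using \<theta>(4) K by (simp add: pos_le_divide_eq)
    show "0 \<le> a / (?K - 1)"
      using K w raise_level_nonneg[of I x r] by (simp add: a_def)
  qed (use y0 yr in \<open>auto intro: sum_nonneg\<close>)
  finally have "(\<Sum>v<num_points I. y v * gap (serve I x r v j)) \<le>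
      (\<Sum>v<num_points I. y v * gap (x v j))
      + (a / (?K - 1) * (real (servers I j) - y r) - y r * a)"
    by (simp add: sum_split_at[OF r, of "\<lambda>v. y v * _ v"] serve_def[of I x r r] at_r algebra_simps)
  also have "a / (?K - 1) * (real (servers I j) - y r) - y r * a =
      a * ((real (servers I j) - y r) / (?K - 1) - y r)"
    by (simp add: algebra_simps)
  finally have "weight I j * (\<Sum>v<num_points I. y v * gap (serve I x r v j)) \<le>
      weight I j * ((\<Sum>v<num_points I. y v * gap (x v j))
      + a * ((real (servers I j) - y r) / (?K - 1) - y r))"
    using w by (intro mult_left_mono) auto
  also have "weight I j * a = raise_level I x r"
    using w by (simp add: a_def)
  then have "weight I j * ((\<Sum>v<num_points I. y v * gap (x v j))
      + a * ((real (servers I j) - y r) / (?K - 1) - y r)) =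
    weight I j * (\<Sum>v<num_points I. y v * gap (x v j))
      + raise_level I x r * ((real (servers I j) - y r) / (capacity I j - 1) - y r)"
    by (simp only: distrib_left mult.assoc[symmetric])
  finally show ?thesis .
qed

end

section \<open>One serving step over all classes\<close>

lemma serve_configuration:
  assumes "valid_instance I" "configuration I x" "r < num_points I"
  shows "configuration I (serve I x r)"
  unfolding configuration_def
proof (intro conjI allI impI)
  fix v j assume v: "v < num_points I" and j: "j < num_weights I"
  obtain \<theta> where \<theta>: "\<theta> \<le> 1" "\<And>v. v \<noteq> r \<Longrightarrow> serve I x r v j = x v j * (1 - \<theta>)"
    using serve_scales[OF assms j] by metis
  have x: "0 \<le> x v j" "0 < weight I j"
    using assms v j by (auto simp: configuration_def valid_instance_def)
  show "0 \<le> serve I x r v j"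
  proof (cases "v = r")
    case True
    then show ?thesis
      using x raise_level_nonneg[of I x r] by (simp add: serve_def raised_def)
  next
    case False
    then show ?thesis
      using x \<theta> by simp
  qed
next
  fix j assume j: "j < num_weights I"
  show "(\<Sum>v<num_points I. serve I x r v j) \<le> capacity I j"
    using serve_scales[OF assms j] by metis
qed

lemma serve_covers:
  assumes "valid_instance I"
  shows "\<exists>j<num_weights I. 1 \<le> serve I x r r j"
proof -
  have "0 < num_weights I"
    using assms by (auto simp: valid_instance_def)
  then obtain j where j: "j < num_weights I" "weight I j * (1 - x r j) \<le> raise_level I x r"
    using raise_level_attained by metis
  moreover have "0 < weight I j"
    using assms j by (simp add: valid_instance_def)
  ultimately have "1 \<le> serve I x r r j"
    by (simp add: serve_def raised_def field_simps)
  then show ?thesis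
    using j by blast
qed

text \<open>With one class the reference solution has at most \<open>k - 1\<close> mass off the request; without
  using this, \<open>l = k = 1\<close> would leave no slack.\<close>

lemma eviction_rate_le:
  assumes valid: "valid_instance I"
    and y0: "\<And>j. j < num_weights I \<Longrightarrow> 0 \<le> y j"
    and cover: "1 \<le> (\<Sum>j<num_weights I. y j)"
  shows "(\<Sum>j<num_weights I. (real (servers I j) - y j) / (capacity I j - 1) - y j) \<le> - 1 / 3"
proof (cases "num_weights I = 1")
  case True
  have k: "1 \<le> real (servers I 0)"
    using valid True by (simp add: valid_instance_def)
  have "(real (servers I 0) - y 0) / (2 * real (servers I 0) - 1) \<le>
      (real (servers I 0) - 1) / (2 * real (servers I 0) - 1)"
    using k cover True by (intro divide_right_mono) auto
  also have "\<dots> \<le> 1 / 2"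
    using k by (simp add: field_simps)
  finally have "(real (servers I 0) - y 0) / (2 * real (servers I 0) - 1) \<le> 1 / 2" .
  moreover have "1 \<le> y 0"
    using cover True by simp
  ultimately have "(real (servers I 0) - y 0) / (2 * real (servers I 0) - 1) - y 0 \<le> - 1 / 3"
    by linarith
  then show ?thesis
    using True by (simp add: capacity_def)
next
  case False
  let ?l = "real (num_weights I)"
  have l: "2 \<le> ?l"
    using valid False by (auto simp: valid_instance_def)
  have "(\<Sum>j<num_weights I. (real (servers I j) - y j) / (capacity I j - 1)) \<le>
      (\<Sum>j<num_weights I. 2 / (3 * ?l))"
  proof (rule sum_mono)
    fix j assume "j \<in> {..<num_weights I}"
    then have j: "j < num_weights I" by simp
    have k: "1 \<le> real (servers I j)"
      using valid j by (auto simp: valid_instance_def)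
    have K: "0 < capacity I j - 1"
      using capacity_ge_2[OF valid j] by simp
    \<comment> \<open>With at least two classes \<open>l * k \<ge> 2\<close>, which is equivalent to
      \<open>3 * l * k \<le> 2 * (2 * l * k - 1)\<close>. Each class then contributes at most
      \<open>2 / (3 * l)\<close>, all of them at most 2/3, against the covered unit.\<close>
    have "2 * 1 \<le> ?l * real (servers I j)"
      using l k by (intro mult_mono) auto
    then have "real (servers I j) * (3 * ?l) \<le> 2 * (capacity I j - 1)"
      by (simp add: capacity_def algebra_simps)
    then have "real (servers I j) / (capacity I j - 1) \<le> 2 / (3 * ?l)"
      using K l by (simp add: field_simps)
    moreover have "(real (servers I j) - y j) / (capacity I j - 1) \<le>
        real (servers I j) / (capacity I j - 1)"
      using K y0[OF j] by (intro divide_right_mono) auto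
    ultimately show "(real (servers I j) - y j) / (capacity I j - 1) \<le> 2 / (3 * ?l)"
      by linarith
  qed
  also have "\<dots> = 2 / 3"
    using l by simp
  finally show ?thesis
    using cover by (simp add: sum_subtractf)
qed

text \<open>The amortized inequality for a fixed reference configuration. The movement is at most
  \<open>2 * l * s\<close> at level \<open>s\<close>, while the potential falls by at least
  \<open>s / 3\<close>; the multiplier \<open>6 * l\<close> balances the two.\<close>

lemma serve_step_le:
  assumes valid: "valid_instance I" and conf: "configuration I x" and r: "r < num_points I"
    and y0: "\<And>v j. v < num_points I \<Longrightarrow> j < num_weights I \<Longrightarrow> 0 \<le> y v j"
    and yk: "\<And>j. j < num_weights I \<Longrightarrow> (\<Sum>v<num_points I. y v j) \<le> real (servers I j)"
    and cover: "1 \<le> (\<Sum>j<num_weights I. y r j)"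
  shows "distance I x (serve I x r) + 6 * real (num_weights I) * potential I y (serve I x r)
    \<le> 6 * real (num_weights I) * potential I y x"
proof -
  let ?l = "real (num_weights I)" and ?s = "raise_level I x r"
  have "distance I x (serve I x r) \<le> (\<Sum>j<num_weights I. 2 * ?s)"
    unfolding distance_def
    using serve_movement_le[OF valid conf r] by (intro sum_mono) auto
  then have d: "distance I x (serve I x r) \<le> 2 * ?l * ?s"
    by simp
  have "potential I y (serve I x r) \<le> (\<Sum>j<num_weights I.
      weight I j * (\<Sum>v<num_points I. y v j * gap (x v j))
      + ?s * ((real (servers I j) - y r j) / (capacity I j - 1) - y r j))"
    unfolding potential_def
    using y0 yk by (intro sum_mono serve_potential_le[OF valid conf r]) auto
  also have "\<dots> = potential I y x
      + ?s * (\<Sum>j<num_weights I. (real (servers I j) - y r j) / (capacity I j - 1) - y r j)"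
    by (simp add: sum.distrib potential_def sum_distrib_left)
  also have "?s * (\<Sum>j<num_weights I. (real (servers I j) - y r j) / (capacity I j - 1) - y r j)
      \<le> ?s * (- 1 / 3)"
    using eviction_rate_le[OF valid _ cover] y0[OF r] raise_level_nonneg
    by (intro mult_left_mono) auto
  finally have "6 * ?l * potential I y (serve I x r) \<le> 6 * ?l * (potential I y x + ?s * (- 1 / 3))"
    by (intro mult_left_mono) auto
  then show ?thesis
    using d by (simp add: algebra_simps)
qed

text \<open>For \<open>x \<ge> 0\<close> every gap lies between 0 and 1, so the potential is
  1-Lipschitz in the reference configuration with respect to \<open>distance\<close>.\<close>

lemma potential_le_add_distance:
  assumes "valid_instance I"
    and "\<And>v j. v < num_points I \<Longrightarrow> j < num_weights I \<Longrightarrow> 0 \<le> x v j"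
  shows "potential I y' x \<le> potential I y x + distance I y y'"
proof -
  have "weight I j * (\<Sum>v<num_points I. y' v j * gap (x v j)) \<le>
      weight I j * (\<Sum>v<num_points I. y v j * gap (x v j))
      + weight I j * (\<Sum>v<num_points I. \<bar>y' v j - y v j\<bar>)" if j: "j < num_weights I" for j
  proof -
    have "(\<Sum>v<num_points I. y' v j * gap (x v j)) \<le>
        (\<Sum>v<num_points I. y v j * gap (x v j) + \<bar>y' v j - y v j\<bar>)"
    proof (rule sum_mono)
      fix v assume "v \<in> {..<num_points I}"
      then have g: "0 \<le> gap (x v j)" "gap (x v j) \<le> 1"
        using assms(2) j by (auto simp: gap_def)
      have "(y' v j - y v j) * gap (x v j) \<le> \<bar>y' v j - y v j\<bar> * 1"
        using g by (intro mult_mono) auto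
      then show "y' v j * gap (x v j) \<le> y v j * gap (x v j) + \<bar>y' v j - y v j\<bar>"
        by (simp add: algebra_simps)
    qed
    moreover have "0 < weight I j"
      using assms(1) j by (simp add: valid_instance_def)
    ultimately show ?thesis
      by (simp add: sum.distrib flip: distrib_left)
  qed
  then show ?thesis
    unfolding potential_def distance_def sum.distrib[symmetric] by (intro sum_mono) auto
qed

lemma potential_nonneg:
  assumes "valid_instance I"
    and "\<And>v j. v < num_points I \<Longrightarrow> j < num_weights I \<Longrightarrow> 0 \<le> y v j"
  shows "0 \<le> potential I y x"
  using assms unfolding potential_def valid_instance_def
  by (intro sum_nonneg mult_nonneg_nonneg) (auto simp: gap_def intro: less_imp_le)

section \<open>From single steps to whole request sequences\<close>

lemma movement_cost_eq_distance:
  "movement_cost I T x = (\<Sum>t=1..T. distance I (\<lambda>v j. x v j (t - 1)) (\<lambda>v j. x v j t)) / 2"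
proof -
  have "(\<Sum>j<num_weights I. weight I j * (\<Sum>t=1..T. \<Sum>v<num_points I. \<bar>x v j t - x v j (t - 1)\<bar>)) =
      (\<Sum>t=1..T. \<Sum>j<num_weights I. weight I j * (\<Sum>v<num_points I. \<bar>x v j t - x v j (t - 1)\<bar>))"
    unfolding sum_distrib_left[where A = "{1..T}"] by (rule sum.swap)
  then show ?thesis
    by (simp add: movement_cost_def distance_def)
qed

lemma trajectory_0: "trajectory serve_all I \<sigma> v j 0 = real (init I v j)"
  by (simp add: trajectory_def serve_all_def)

lemma trajectory_Suc:
  assumes "t < length \<sigma>"
  shows "(\<lambda>v j. trajectory serve_all I \<sigma> v j (Suc t)) =
    serve I (\<lambda>v j. trajectory serve_all I \<sigma> v j t) (\<sigma> ! t)"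
  using assms by (simp add: trajectory_def serve_all_def take_Suc_conv_app_nth)

lemma valid_requests_nth:
  assumes "valid_requests I \<sigma>" "t < length \<sigma>"
  shows "\<sigma> ! t < num_points I"
  using assms nth_mem unfolding valid_requests_def by blast

lemma trajectory_configuration:
  assumes valid: "valid_instance I" and req: "valid_requests I \<sigma>"
  shows "t \<le> length \<sigma> \<Longrightarrow> configuration I (\<lambda>v j. trajectory serve_all I \<sigma> v j t)"
proof (induction t)
  case 0
  have "(\<Sum>v<num_points I. real (init I v j)) \<le> capacity I j" if j: "j < num_weights I" for j
  proof -
    have "(\<Sum>v<num_points I. init I v j) \<le> servers I j"
      using valid j by (simp add: valid_instance_def)
    also have "\<dots> \<le> 2 * num_weights I * servers I j"
      using j by (cases "num_weights I") auto
    finally have "real (\<Sum>v<num_points I. init I v j) \<le> real (2 * num_weights I * servers I j)"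
      by (simp only: of_nat_le_iff)
    then show ?thesis
      by (simp add: capacity_def)
  qed
  then show ?case
    by (simp add: configuration_def trajectory_0)
next
  case (Suc t)
  then show ?case
    using serve_configuration valid valid_requests_nth[OF req] by (simp add: trajectory_Suc)
qed

lemma trajectory_fractional_solution:
  assumes "valid_instance I" "valid_requests I \<sigma>"
  shows "fractional_solution I (\<lambda>j. 2 * num_weights I * servers I j) (length \<sigma>)
    (trajectory serve_all I \<sigma>)"
  using trajectory_configuration[OF assms]
  by (simp add: fractional_solution_def trajectory_0 configuration_def capacity_def)

lemma trajectory_single_weight_service:
  assumes "valid_instance I"
  shows "single_weight_service I \<sigma> (trajectory serve_all I \<sigma>)"
  unfolding single_weight_service_def
proof
  fix t assume "t \<in> {1..length \<sigma>}"
  then obtain u where u: "t = Suc u" "u < length \<sigma>"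
    by (cases t) auto
  show "\<exists>j<num_weights I. 1 \<le> trajectory serve_all I \<sigma> (\<sigma> ! (t - 1)) j t"
    using serve_covers[OF assms] trajectory_Suc[OF u(2), of I] u(1)
    by (metis diff_Suc_1)
qed

lemma trajectory_cost_le:
  assumes valid: "valid_instance I" and req: "valid_requests I \<sigma>" and y: "lp_feasible I \<sigma> y"
  shows "movement_cost I (length \<sigma>) (trajectory serve_all I \<sigma>)
    \<le> 6 * real (num_weights I) * movement_cost I (length \<sigma>) y"
proof -
  define X where "X t = (\<lambda>v j. trajectory serve_all I \<sigma> v j t)" for t
  define Y where "Y t = (\<lambda>v j. y v j t)" for t
  let ?l = "6 * real (num_weights I)"
  have Y0: "0 \<le> Y t v j" if "t \<le> length \<sigma>" "v < num_points I" "j < num_weights I" for t v j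
    using y that by (simp add: lp_feasible_def fractional_solution_def Y_def)
  have Yk: "(\<Sum>v<num_points I. Y t v j) \<le> real (servers I j)"
    if "t \<le> length \<sigma>" "j < num_weights I" for t j
    using y that by (simp add: lp_feasible_def fractional_solution_def Y_def)
  have Yc: "1 \<le> (\<Sum>j<num_weights I. Y (Suc t) (\<sigma> ! t) j)" if "t < length \<sigma>" for t
    using y that by (force simp: lp_feasible_def Y_def)
  have main: "T \<le> length \<sigma> \<Longrightarrow>
      (\<Sum>t=1..T. distance I (X (t - 1)) (X t)) + ?l * potential I (Y T) (X T)
      \<le> ?l * (\<Sum>t=1..T. distance I (Y (t - 1)) (Y t))" for T
  proof (induction T)
    case 0
    \<comment> \<open>Both solutions start in the same integral configuration: no server at
      \<open>v\<close> annihilates the reference mass, at least one annihilates the gap. Thus the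
      initial potential vanishes and no additive constant remains.\<close>
    have "real (init I v j) * gap (real (init I v j)) = 0" for v j
      by (cases "init I v j") (auto simp: gap_def)
    moreover have "Y 0 v j = real (init I v j)" if "v < num_points I" "j < num_weights I" for v j
      using y that by (simp add: lp_feasible_def fractional_solution_def Y_def)
    ultimately have "Y 0 v j * gap (X 0 v j) = 0"
      if "v < num_points I" "j < num_weights I" for v j
      using that by (simp add: X_def trajectory_0)
    then have "(\<Sum>v<num_points I. Y 0 v j * gap (X 0 v j)) = 0" if "j < num_weights I" for j
      using that by (intro sum.neutral) blast
    then have "potential I (Y 0) (X 0) = 0"
      by (simp add: potential_def)
    then show ?case by simp
  next
    case (Suc T)
    then have T: "T < length \<sigma>" by simp
    have conf: "configuration I (X T)"
      using trajectory_configuration[OF valid req] T by (simp add: X_def)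
    have X: "X (Suc T) = serve I (X T) (\<sigma> ! T)"
      using trajectory_Suc[OF T] by (simp add: X_def)
    \<comment> \<open>The reference is thought to move first, against the old \<open>X T\<close>.
      The serving step is then compared with \<open>Y (Suc T)\<close>, which already covers the
      request \<open>\<sigma> ! T\<close> of time \<open>Suc T\<close>.\<close>
    have "distance I (X T) (X (Suc T)) + ?l * potential I (Y (Suc T)) (X (Suc T))
        \<le> ?l * potential I (Y (Suc T)) (X T)"
      unfolding X using T Y0 Yk Yc
      by (intro serve_step_le valid conf valid_requests_nth[OF req]) auto
    also have "\<dots> \<le> ?l * (potential I (Y T) (X T) + distance I (Y T) (Y (Suc T)))"
      using conf by (intro mult_left_mono potential_le_add_distance valid)
        (auto simp: configuration_def)
    finally show ?case
      using Suc by (simp add: algebra_simps)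
  qed
  have "0 \<le> ?l * potential I (Y (length \<sigma>)) (X (length \<sigma>))"
    using Y0 by (intro mult_nonneg_nonneg potential_nonneg valid) auto
  then show ?thesis
    using main[of "length \<sigma>"] by (simp add: movement_cost_eq_distance X_def Y_def)
qed

text \<open>Makes the infimum in \<open>lp_opt\<close> meaningful. The witness keeps a single unit
  of class 0 at the current request and sends all other mass outside of the space, which the
  capacity inequalities allow.\<close>

lemma lp_feasible_nonempty:
  assumes valid: "valid_instance I" and req: "valid_requests I \<sigma>"
  shows "{x. lp_feasible I \<sigma> x} \<noteq> {}"
proof -
  define y :: "nat \<Rightarrow> nat \<Rightarrow> nat \<Rightarrow> real" where
    "y v j t = (if t = 0 then real (init I v j) else of_bool (v = \<sigma> ! (t - 1) \<and> j = 0))" for v j t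
  have cap: "(\<Sum>v<num_points I. y v j t) \<le> real (servers I j)" if "j < num_weights I" for j t
  proof (cases t)
    case 0
    have "(\<Sum>v<num_points I. init I v j) \<le> servers I j"
      using valid that by (simp add: valid_instance_def)
    then show ?thesis
      using 0 by (simp add: y_def flip: of_nat_sum)
  next
    case (Suc u)
    have "(\<Sum>v<num_points I. y v j t) \<le> (\<Sum>v<num_points I. if v = \<sigma> ! u then 1 else 0)"
      using Suc by (intro sum_mono) (simp add: y_def)
    also have "\<dots> \<le> 1"
      by (simp add: sum.delta)
    also have "\<dots> \<le> real (servers I j)"
      using valid that by (auto simp: valid_instance_def)
    finally show ?thesis .
  qed
  have "1 \<le> (\<Sum>j<num_weights I. y (\<sigma> ! (t - 1)) j t)" if "t \<in> {1..length \<sigma>}" for t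
  proof -
    have "y (\<sigma> ! (t - 1)) 0 t \<le> (\<Sum>j<num_weights I. y (\<sigma> ! (t - 1)) j t)"
      using valid by (intro member_le_sum) (auto simp: valid_instance_def y_def)
    then show ?thesis
      using that by (simp add: y_def)
  qed
  with cap have "lp_feasible I \<sigma> y"
    by (simp add: lp_feasible_def fractional_solution_def) (simp add: y_def)
  then show ?thesis by blast
qed

text \<open>Divided by \<open>6 * l\<close>, the cost of the algorithm is a lower bound for all
  feasible costs, hence for their infimum; no optimal solution has to be chosen.\<close>

lemma trajectory_competitive:
  assumes valid: "valid_instance I" and req: "valid_requests I \<sigma>"
  shows "movement_cost I (length \<sigma>) (trajectory serve_all I \<sigma>)
    \<le> 6 * real (num_weights I) * lp_opt I \<sigma>"
proof -
  have l: "0 < 6 * real (num_weights I)"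
    using valid by (auto simp: valid_instance_def)
  have "movement_cost I (length \<sigma>) (trajectory serve_all I \<sigma>) / (6 * real (num_weights I))
      \<le> lp_opt I \<sigma>"
    unfolding lp_opt_def
  proof (rule cInf_greatest)
    show "movement_cost I (length \<sigma>) ` {x. lp_feasible I \<sigma> x} \<noteq> {}"
      using lp_feasible_nonempty[OF assms] by simp
    fix c assume "c \<in> movement_cost I (length \<sigma>) ` {x. lp_feasible I \<sigma> x}"
    then show "movement_cost I (length \<sigma>) (trajectory serve_all I \<sigma>)
        / (6 * real (num_weights I)) \<le> c"
      using trajectory_cost_le[OF assms] l by (auto simp: field_simps)
  qed
  then show ?thesis
    using l by (simp add: field_simps)
qed

section \<open>Total correctness with time bounds\<close>

text \<open>Existence of a run with an upper bound on its length. As the postcondition is a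
  predicate on states, nesting this notion gives a weakest precondition calculus that adds up time
  bounds.\<close>

definition halts_within ::
    "com \<Rightarrow> nat \<Rightarrow> ram_state \<Rightarrow> (ram_state \<Rightarrow> bool) \<Rightarrow> bool" where
  "halts_within c t s Q \<longleftrightarrow> (\<exists>t' s'. runs c s t' s' \<and> t' \<le> t \<and> Q s')"

lemma halts_within_mono:
  assumes "halts_within c t s Q" "t \<le> t'" "\<And>s. Q s \<Longrightarrow> Q' s"
  shows "halts_within c t' s Q'"
  using assms unfolding halts_within_def by (blast intro: order_trans)

lemma halts_within_Skip:
  "Q s \<Longrightarrow> halts_within Skip 1 s Q"
  unfolding halts_within_def by (intro exI[of _ 1] exI conjI, rule runs.Skip) auto

lemma halts_within_NAssign:
  "Q (upd (fst s) a (nval i s) (nval e s), snd s) \<Longrightarrow> halts_within (NAssign a i e) 1 s Q"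
  unfolding halts_within_def by (intro exI[of _ 1] exI conjI, rule runs.NAssign) auto

lemma halts_within_RAssign:
  "Q (fst s, upd (snd s) a (nval i s) (rval e s)) \<Longrightarrow> halts_within (RAssign a i e) 1 s Q"
  unfolding halts_within_def by (intro exI[of _ 1] exI conjI, rule runs.RAssign) auto

lemma halts_within_Seq:
  assumes "halts_within c1 t1 s (\<lambda>s'. halts_within c2 t2 s' Q)"
  shows "halts_within (Seq c1 c2) (t1 + t2) s Q"
proof -
  obtain t1' s1 t2' s2 where "runs c1 s t1' s1" "t1' \<le> t1" "runs c2 s1 t2' s2" "t2' \<le> t2" "Q s2"
    using assms by (auto simp: halts_within_def)
  then have "runs (Seq c1 c2) s (t1' + t2') s2" "t1' + t2' \<le> t1 + t2" "Q s2"
    by (auto intro: runs.Seq)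
  then show ?thesis
    unfolding halts_within_def by blast
qed

text \<open>The branch bounds are added instead of maximized, which keeps the time terms polynomial
  expressions.\<close>

lemma halts_within_Cond:
  assumes "bval b s \<Longrightarrow> halts_within c1 t1 s Q" "\<not> bval b s \<Longrightarrow> halts_within c2 t2 s Q"
  shows "halts_within (Cond b c1 c2) (t1 + t2 + 1) s Q"
proof (cases "bval b s")
  case True
  then obtain t' s' where "runs c1 s t' s'" "t' \<le> t1" "Q s'"
    using assms by (auto simp: halts_within_def)
  then show ?thesis
    using True runs.CondTrue[of b s c1 t' s' c2] unfolding halts_within_def
    by (intro exI[of _ "t' + 1"] exI[of _ s']) auto
next
  case False
  then obtain t' s' where "runs c2 s t' s'" "t' \<le> t2" "Q s'"
    using assms by (auto simp: halts_within_def)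
  then show ?thesis
    using False runs.CondFalse[of b s c2 t' s' c1] unfolding halts_within_def
    by (intro exI[of _ "t' + 1"] exI[of _ s']) auto
qed

lemma halts_within_While:
  assumes inv: "P i s" and le: "i \<le> n"
    and guard: "\<And>i s. P i s \<Longrightarrow> i \<le> n \<Longrightarrow> bval b s \<longleftrightarrow> i < n"
    and body: "\<And>i s. P i s \<Longrightarrow> i < n \<Longrightarrow> halts_within c t s (P (Suc i))"
  shows "halts_within (While b c) ((n - i) * (t + 1) + 1) s (P n)"
  using inv le
proof (induction "n - i" arbitrary: i s)
  case 0
  then have "\<not> bval b s" "i = n"
    using guard[of i s] by auto
  then show ?case
    using 0 runs.WhileFalse[of b s c] unfolding halts_within_def
    by (intro exI[of _ 1] exI[of _ s]) auto
next
  case (Suc m)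
  then have i: "i < n" and b: "bval b s"
    using guard[of i s] by auto
  then obtain t1 s1 where 1: "runs c s t1 s1" "t1 \<le> t" "P (Suc i) s1"
    using body[of i s] Suc.prems by (auto simp: halts_within_def)
  have "halts_within (While b c) ((n - Suc i) * (t + 1) + 1) s1 (P n)"
    using Suc.hyps(2) i by (intro Suc.hyps(1) 1(3)) auto
  then obtain t2 s2 where
    2: "runs (While b c) s1 t2 s2" "t2 \<le> (n - Suc i) * (t + 1) + 1" "P n s2"
    by (auto simp: halts_within_def)
  have "(n - i) * (t + 1) = (n - Suc i) * (t + 1) + (t + 1)"
    using i by (metis Suc_diff_Suc add.commute mult_Suc)
  then have "t1 + t2 + 1 \<le> (n - i) * (t + 1) + 1"
    using 1 2 by linarith
  then show ?case
    using runs.WhileTrue[OF b 1(1) 2(1)] 2(3) unfolding halts_within_def by blast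
qed

section \<open>Scalar variables and counting loops\<close>

abbreviation NVar :: "nat \<Rightarrow> nexp" where
  "NVar a \<equiv> NCell a (NConst 0)"

abbreviation RVar :: "nat \<Rightarrow> rexp" where
  "RVar a \<equiv> RCell a (NConst 0)"

abbreviation NSet :: "nat \<Rightarrow> nexp \<Rightarrow> com" where
  "NSet a e \<equiv> NAssign a (NConst 0) e"

abbreviation RSet :: "nat \<Rightarrow> rexp \<Rightarrow> com" where
  "RSet a e \<equiv> RAssign a (NConst 0) e"

definition For :: "nat \<Rightarrow> nexp \<Rightarrow> com \<Rightarrow> com" where
  "For a e c = Seq (NSet a (NConst 0))
     (While (NLess (NVar a) e) (Seq c (NSet a (NAdd (NVar a) (NConst 1)))))"

text \<open>The \<open>+ 2\<close> per round pays for the increment and the test, the final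
  \<open>+ 2\<close> for the initialization and the failing test. \<open>While\<close> re-evaluates
  \<open>e\<close> in every round, so the invariant has to fix its value.\<close>

lemma halts_within_For:
  assumes start: "P 0 (upd (fst s) a 0 0, snd s)"
    and counter: "\<And>i s. P i s \<Longrightarrow> fst s a 0 = i"
    and bound: "\<And>i s. P i s \<Longrightarrow> nval e s = n"
    and body: "\<And>i s. P i s \<Longrightarrow> i < n \<Longrightarrow>
      halts_within c t s (\<lambda>s'. P (Suc i) (upd (fst s') a 0 (Suc (fst s' a 0)), snd s'))"
    and post: "\<And>s. P n s \<Longrightarrow> Q s"
  shows "halts_within (For a e c) (n * (t + 2) + 2) s Q"
proof -
  have "halts_within (Seq c (NSet a (NAdd (NVar a) (NConst 1)))) (t + 1) s (P (Suc i))"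
    if "P i s" "i < n" for i s
    by (rule halts_within_Seq, rule halts_within_mono[OF body[OF that] order_refl],
        rule halts_within_NAssign) simp
  then have "halts_within (While (NLess (NVar a) e) (Seq c (NSet a (NAdd (NVar a) (NConst 1)))))
      ((n - 0) * ((t + 1) + 1) + 1) (upd (fst s) a 0 0, snd s) (P n)"
    using counter bound by (intro halts_within_While[where P = P] start) auto
  then have "halts_within (For a e c) (1 + ((n - 0) * ((t + 1) + 1) + 1)) s (P n)"
    unfolding For_def by (intro halts_within_Seq halts_within_NAssign) simp
  then show ?thesis
    by (rule halts_within_mono) (use post in auto)
qed

section \<open>The program\<close>

lemmas halts_within_simple =
  halts_within_Seq halts_within_Cond halts_within_Skip halts_within_NAssign halts_within_RAssign

lemma halts_within_le:
  "halts_within c t s Q \<Longrightarrow> t \<le> t' \<Longrightarrow> halts_within c t' s Q"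
  by (rule halts_within_mono)

lemma upd_apply [simp]: "upd m a i y b k = (if b = a \<and> k = i then y else m b k)"
  by (simp add: upd_def)

lemma upd_row [simp]: "b \<noteq> a \<Longrightarrow> upd m a i y b = m b"
  by (simp add: upd_def)

section \<open>Memory layout of the input and of the current configuration\<close>

definition keeps_input :: "server_instance \<Rightarrow> nat list \<Rightarrow> ram_state \<Rightarrow> bool" where
  "keeps_input I \<sigma> s \<longleftrightarrow>
     (\<forall>a\<le>3. fst s a = fst (input_state I \<sigma>) a) \<and> snd s 0 = snd (input_state I \<sigma>) 0"

definition stores :: "server_instance \<Rightarrow> (nat \<Rightarrow> nat \<Rightarrow> real) \<Rightarrow> ram_state \<Rightarrow> bool" where
  "stores I x s \<longleftrightarrow> (\<forall>v<num_points I. \<forall>j<num_weights I. ram_output I s v j = x v j)"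

lemma keeps_input_upd [simp]:
  "3 < a \<Longrightarrow> keeps_input I \<sigma> (upd m a i y, g) \<longleftrightarrow> keeps_input I \<sigma> (m, g)"
  "a \<noteq> 0 \<Longrightarrow> keeps_input I \<sigma> (m, upd g a i z) \<longleftrightarrow> keeps_input I \<sigma> (m, g)"
  by (auto simp: keeps_input_def)

lemma keeps_input_simps:
  assumes "keeps_input I \<sigma> s"
  shows "fst s 0 0 = num_points I" "fst s 0 (Suc 0) = num_weights I" "fst s 0 2 = length \<sigma>"
    "t < length \<sigma> \<Longrightarrow> fst s (Suc 0) t = \<sigma> ! t"
    "j < num_weights I \<Longrightarrow> fst s 2 j = servers I j"
    "i < num_points I * num_weights I \<Longrightarrow>
      fst s 3 i = init I (i div num_weights I) (i mod num_weights I)"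
    "j < num_weights I \<Longrightarrow> snd s 0 j = weight I j"
  using assms by (auto simp: keeps_input_def input_state_def)

lemma stores_upd [simp]:
  "stores I x (upd m a i y, g) \<longleftrightarrow> stores I x (m, g)"
  "a \<noteq> 1 \<Longrightarrow> stores I x (m, upd g a i z) \<longleftrightarrow> stores I x (m, g)"
  by (auto simp: stores_def ram_output_def)

lemma row_major_eq_iff:
  fixes l :: nat
  assumes "j < l" "j' < l"
  shows "v * l + j = v' * l + j' \<longleftrightarrow> v = v' \<and> j = j'"
proof
  assume eq: "v * l + j = v' * l + j'"
  have "(v * l + j) div l = v" "(v' * l + j') div l = v'"
    using assms by auto
  then show "v = v' \<and> j = j'"
    using eq by auto
qed simp

lemma row_major_less:
  fixes l :: nat
  assumes "j < l" "v < n"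
  shows "v * l + j < n * l"
proof -
  have "v * l + j < Suc v * l"
    using assms by simp
  also have "\<dots> \<le> n * l"
    using assms by (intro mult_le_mono) auto
  finally show ?thesis .
qed

lemma stores_D:
  assumes "stores I x s" "v < num_points I" "j < num_weights I"
  shows "snd s (Suc 0) (v * num_weights I + j) = x v j"
  using assms by (simp add: stores_def ram_output_def)

lemma stores_write:
  assumes "stores I x (m, g)" "j < num_weights I" "i = v * num_weights I + j"
    and "\<And>v' j'. v' < num_points I \<Longrightarrow> j' < num_weights I \<Longrightarrow>
      x' v' j' = (if v' = v \<and> j' = j then y else x v' j')"
  shows "stores I x' (m', upd g (Suc 0) i y)"
  using assms row_major_eq_iff by (simp add: stores_def ram_output_def)

lemma stores_cong:
  assumes "stores I x s"
    and "\<And>v j. v < num_points I \<Longrightarrow> j < num_weights I \<Longrightarrow> x' v j = x v j"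
  shows "stores I x' s"
  using assms by (simp add: stores_def)

text \<open>Scalar variables are the zeroth cells of the arrays that hold no input or output. Natural
  number array 4 is the index of the current request, 5 the address of its row in the
  configuration, 6 and 7 count points and classes, 8 is an address running through the
  configuration. Real arrays 2 to 5 are the raise level, the load of a class, the raised mass at
  the request and the scaling factor.\<close>

definition load_program :: com where
  "load_program =
     Seq (NSet 8 (NConst 0))
      (For 6 (NCell 0 (NConst 0)) (For 7 (NCell 0 (NConst 1))
        (Seq (RAssign 1 (NVar 8) (RNat (NCell 3 (NVar 8))))
             (NSet 8 (NAdd (NVar 8) (NConst 1))))))"

text \<open>Index expressions have no multiplication, so the row address \<open>r * l\<close> is
  built by \<open>r\<close> additions.\<close>

definition row_program :: com where
  "row_program =
     Seq (NSet 5 (NConst 0))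
      (For 6 (NCell 1 (NVar 4)) (NSet 5 (NAdd (NVar 5) (NCell 0 (NConst 1)))))"

definition level_exp :: "nexp \<Rightarrow> rexp" where
  "level_exp e = RMul (RCell 0 e) (RSub (RConst 1) (RCell 1 (NAdd (NVar 5) e)))"

text \<open>The running minimum starts from class 0, and the loop looks at that class once more. The
  last conditional is the \<open>max 0\<close> of \<open>raise_level\<close>.\<close>

definition level_program :: com where
  "level_program =
     Seq (RSet 2 (level_exp (NConst 0)))
      (Seq (For 7 (NCell 0 (NConst 1))
             (Cond (RLess (level_exp (NVar 7)) (RVar 2)) (RSet 2 (level_exp (NVar 7))) Skip))
           (Cond (RLess (RVar 2) (RConst 0)) (RSet 2 (RConst 0)) Skip))"

definition column_program :: "com \<Rightarrow> com" where
  "column_program c =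
     Seq (NSet 8 (NVar 7))
      (For 6 (NCell 0 (NConst 0)) (Seq c (NSet 8 (NAdd (NVar 8) (NCell 0 (NConst 1))))))"

definition capacity_exp :: rexp where
  "capacity_exp =
     RMul (RMul (RConst 2) (RNat (NCell 0 (NConst 1)))) (RNat (NCell 2 (NVar 7)))"

text \<open>The raised mass is written before the column is summed, so the sum is the load. Scaling
  runs over the whole column including the entry at \<open>r\<close>, which is restored afterwards
  from real array 4; this avoids an equality test in the loop.\<close>

definition class_program :: com where
  "class_program =
     Seq (RSet 4 (RAdd (RCell 1 (NAdd (NVar 5) (NVar 7))) (RDiv (RVar 2) (RCell 0 (NVar 7)))))
     (Seq (RAssign 1 (NAdd (NVar 5) (NVar 7)) (RVar 4))
     (Seq (RSet 3 (RConst 0))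
     (Seq (column_program (RSet 3 (RAdd (RVar 3) (RCell 1 (NVar 8)))))
          (Cond (RLess capacity_exp (RVar 3))
            (Seq (RSet 5 (RDiv (RSub capacity_exp (RVar 4)) (RSub (RVar 3) (RVar 4))))
            (Seq (column_program (RAssign 1 (NVar 8) (RMul (RCell 1 (NVar 8)) (RVar 5))))
                 (RAssign 1 (NAdd (NVar 5) (NVar 7)) (RVar 4))))
            Skip))))"

text \<open>The level depends on all classes at the request and is therefore fixed before any class
  changes. After that each class touches only its own column.\<close>

definition serve_program :: com where
  "serve_program =
     Seq row_program (Seq level_program (For 7 (NCell 0 (NConst 1)) class_program))"

definition main_program :: com where
  "main_program = Seq load_program (For 4 (NCell 0 (NConst 2)) serve_program)"

section \<open>Verification of the program, fragment by fragment\<close>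

context
  fixes I :: server_instance and \<sigma> :: "nat list" and n l :: nat
  assumes valid: "valid_instance I" and req: "valid_requests I \<sigma>"
  defines "n \<equiv> num_points I" and "l \<equiv> num_weights I"
begin

lemmas input_simps = keeps_input_simps[of I \<sigma>]

lemma load_program_halts:
  assumes "keeps_input I \<sigma> s"
  shows "halts_within load_program (n * (l * 4 + 4) + 3) s
    (\<lambda>s. keeps_input I \<sigma> s \<and> stores I (\<lambda>v j. real (init I v j)) s)"
proof -
  \<comment> \<open>A single address \<open>b\<close> stands for both counters: in row-major order
    it equals \<open>u * l + j\<close>, and the end of row \<open>u\<close> is the beginning of the
    next one.\<close>
  define Inv where "Inv b s \<longleftrightarrow> keeps_input I \<sigma> s \<and> fst s 8 0 = b \<and>
    (\<forall>i<b. snd s 1 i = real (init I (i div l) (i mod l)))" for b s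
  have inner: "halts_within
      (Seq (RAssign 1 (NVar 8) (RNat (NCell 3 (NVar 8)))) (NSet 8 (NAdd (NVar 8) (NConst 1)))) 2 s
      (\<lambda>s'. (fst s' 6 0 = u \<and> Inv (u * l + Suc j) (upd (fst s') 7 0 (Suc (fst s' 7 0)), snd s'))
        \<and> fst s' 7 0 = j)"
    if "fst s 6 0 = u" "fst s 7 0 = j" "Inv (u * l + j) s" "u < n" "j < l" for u j s
    apply (rule halts_within_le, (rule halts_within_simple)+)
    using that row_major_less[of j l u n]
    by (auto simp: Inv_def less_Suc_eq input_simps n_def l_def)
  have outer: "halts_within (For 7 (NCell 0 (NConst 1))
        (Seq (RAssign 1 (NVar 8) (RNat (NCell 3 (NVar 8)))) (NSet 8 (NAdd (NVar 8) (NConst 1)))))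
      (l * (2 + 2) + 2) s
      (\<lambda>s'. Inv (Suc u * l) (upd (fst s') 6 0 (Suc (fst s' 6 0)), snd s') \<and> fst s' 6 0 = u)"
    if "fst s 6 0 = u" "Inv (u * l) s" "u < n" for u s
    apply (rule halts_within_For[where
          P = "\<lambda>j s. fst s 6 0 = u \<and> fst s 7 0 = j \<and> Inv (u * l + j) s"])
    subgoal using that by (simp add: Inv_def)
    subgoal by simp
    subgoal by (simp add: Inv_def input_simps l_def)
    subgoal for j s by (rule halts_within_mono[OF inner[of s u j]]) (use that in auto)
    subgoal using that by (simp add: Inv_def add.commute)
    done
  have "halts_within load_program (1 + (n * ((l * (2 + 2) + 2) + 2) + 2)) s
    (\<lambda>s. keeps_input I \<sigma> s \<and> stores I (\<lambda>v j. real (init I v j)) s)"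
    unfolding load_program_def
    apply (rule halts_within_Seq, rule halts_within_NAssign)
    apply (rule halts_within_For[where P = "\<lambda>u s. fst s 6 0 = u \<and> Inv (u * l) s"])
    subgoal using assms by (simp add: Inv_def)
    subgoal by simp
    subgoal by (simp add: Inv_def input_simps n_def)
    subgoal for u s by (rule halts_within_mono[OF outer[of s u]]) auto
    subgoal using row_major_less
      by (auto simp: Inv_def stores_def ram_output_def n_def l_def)
    done
  then show ?thesis
    by (rule halts_within_le) (simp add: algebra_simps)
qed

lemma row_program_halts:
  assumes "keeps_input I \<sigma> s" "stores I x s" "fst s 4 0 = t" "t < length \<sigma>"
  shows "halts_within row_program (n * 3 + 3) s
    (\<lambda>s. keeps_input I \<sigma> s \<and> stores I x s \<and> fst s 4 0 = t \<and> fst s 5 0 = \<sigma> ! t * l)"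
proof -
  have "\<sigma> ! t \<le> n"
    using valid_requests_nth[OF req assms(4)] by (simp add: n_def)
  have "halts_within row_program (1 + (\<sigma> ! t * (1 + 2) + 2)) s
    (\<lambda>s. keeps_input I \<sigma> s \<and> stores I x s \<and> fst s 4 0 = t \<and> fst s 5 0 = \<sigma> ! t * l)"
    unfolding row_program_def
    apply (rule halts_within_Seq, rule halts_within_NAssign)
    apply (rule halts_within_For[where P = "\<lambda>u s. keeps_input I \<sigma> s \<and> stores I x s \<and>
          fst s 4 0 = t \<and> fst s 6 0 = u \<and> fst s 5 0 = u * l"])
    subgoal using assms by simp
    subgoal by simp
    subgoal using assms by (simp add: input_simps)
    subgoal by (rule halts_within_NAssign) (simp add: input_simps l_def)
    subgoal by simp
    done
  then show ?thesis
    by (rule halts_within_le) (use \<open>\<sigma> ! t \<le> n\<close> in simp)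
qed

lemma level_program_halts:
  assumes "keeps_input I \<sigma> s" "stores I x s" "fst s 4 0 = t" "fst s 5 0 = r * l" "r < n"
  shows "halts_within level_program (l * 5 + 6) s
    (\<lambda>s. keeps_input I \<sigma> s \<and> stores I x s \<and> fst s 4 0 = t \<and> fst s 5 0 = r * l \<and>
      snd s 2 0 = raise_level I x r)"
proof -
  define g where "g j = weight I j * (1 - x r j)" for j
  \<comment> \<open>Inserting 0 keeps the set nonempty at \<open>j = 0\<close>, in accordance with
    the initial assignment. At \<open>j = l\<close> the insertion is absorbed.\<close>
  define low where "low j = Min (g ` insert 0 {..<j})" for j
  have low_0: "low 0 = g 0"
    by (simp add: low_def)
  have low_Suc: "low (Suc j) = min (g j) (low j)" for j
    unfolding low_def by (subst Min_insert[symmetric]) (auto simp: lessThan_Suc insert_commute)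
  define Inv where "Inv j s \<longleftrightarrow> keeps_input I \<sigma> s \<and> stores I x s \<and> fst s 4 0 = t \<and>
    fst s 5 0 = r * l \<and> fst s 7 0 = j \<and> snd s 2 0 = low j" for j s
  have l0: "0 < l"
    using valid by (auto simp: valid_instance_def l_def)
  have level: "rval (level_exp e) s = g (nval e s)"
    if "keeps_input I \<sigma> s" "stores I x s" "fst s 5 0 = r * l" "nval e s < l" for e s
    using that assms(5) stores_D[of I x s r "nval e s"]
    by (simp add: level_exp_def g_def input_simps n_def l_def)
  have body: "halts_within
      (Cond (RLess (level_exp (NVar 7)) (RVar 2)) (RSet 2 (level_exp (NVar 7))) Skip) 3 s
      (\<lambda>s'. Inv (Suc j) (upd (fst s') 7 0 (Suc (fst s' 7 0)), snd s'))"
    if "Inv j s" "j < l" for j s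
    using that level[of s "NVar 7"]
    by (intro halts_within_le[OF halts_within_Cond[OF halts_within_RAssign halts_within_Skip]])
      (auto simp: Inv_def low_Suc)
  have level_eq: "raise_level I x r = max 0 (low l)"
    using l0 by (simp add: raise_level_def low_def g_def l_def insert_absorb)
  have "halts_within level_program (1 + ((l * (3 + 2) + 2) + (1 + 1 + 1))) s
    (\<lambda>s. keeps_input I \<sigma> s \<and> stores I x s \<and> fst s 4 0 = t \<and> fst s 5 0 = r * l \<and>
      snd s 2 0 = raise_level I x r)"
    unfolding level_program_def
    apply (rule halts_within_Seq, rule halts_within_RAssign, rule halts_within_Seq)
    apply (rule halts_within_For[where P = Inv])
    subgoal using assms l0 level[of s "NConst 0"] by (simp add: Inv_def low_0)
    subgoal by (simp add: Inv_def)
    subgoal by (simp add: Inv_def input_simps l_def)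
    subgoal by (rule body)
    subgoal
      by (intro halts_within_Cond halts_within_RAssign halts_within_Skip)
        (auto simp: Inv_def level_eq)
    done
  then show ?thesis
    by (rule halts_within_le) simp
qed

text \<open>Loop rule for a walk down column \<open>j\<close>, whose addresses are
  \<open>u * l + j\<close>. \<open>P u\<close> describes the state after \<open>u\<close> points;
  the frame condition makes it insensitive to the counters 6 and 8, which the loop itself
  updates.\<close>

lemma column_program_halts:
  assumes start: "P 0 s" and j: "j < l"
    and inv: "\<And>u s. P u s \<Longrightarrow> keeps_input I \<sigma> s \<and> fst s 7 0 = j"
    and frame: "\<And>u s a y. P u s \<Longrightarrow> a = 6 \<or> a = 8 \<Longrightarrow> P u (upd (fst s) a 0 y, snd s)"
    and body: "\<And>u s. P u s \<Longrightarrow> u < n \<Longrightarrow> fst s 8 0 = u * l + j \<Longrightarrow>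
      halts_within c 1 s (\<lambda>s'. P (Suc u) s' \<and> fst s' 8 0 = u * l + j \<and> fst s' 6 0 = fst s 6 0)"
  shows "halts_within (column_program c) (n * 4 + 3) s (P n)"
proof -
  have "halts_within (column_program c) (1 + (n * ((1 + 1) + 2) + 2)) s (P n)"
    unfolding column_program_def
    apply (rule halts_within_Seq, rule halts_within_NAssign)
    apply (rule halts_within_For[where
          P = "\<lambda>u s. P u s \<and> fst s 6 0 = u \<and> fst s 8 0 = u * l + j"])
    subgoal using frame[OF frame[OF start, of 8 j], of 6 0] inv[OF start] by simp
    subgoal by simp
    subgoal for u s using inv[of u s] by (simp add: input_simps n_def)
    subgoal for u s
      apply (rule halts_within_Seq)
      apply (rule halts_within_mono[OF body[of u s] order_refl])
      subgoal by simp
      subgoal by simp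
      subgoal by simp
      subgoal for s'
        apply (rule halts_within_NAssign)
        using frame[OF frame[of "Suc u" s' 8 "Suc u * l + j"], of 6 "Suc u"] inv[of "Suc u" s']
        by (simp add: input_simps l_def add.commute add.left_commute)
      done
    subgoal by simp
    done
  then show ?thesis
    by (rule halts_within_le) simp
qed

lemma class_program_halts:
  assumes s: "keeps_input I \<sigma> s"
      "stores I (\<lambda>v i. if i < j then serve I x r v i else x v i) s"
      "fst s 4 0 = t" "fst s 5 0 = r * l" "fst s 7 0 = j" "snd s 2 0 = raise_level I x r"
    and r: "r < n" and j: "j < l"
  shows "halts_within class_program (n * 8 + 14) s
    (\<lambda>s. keeps_input I \<sigma> s \<and> stores I (\<lambda>v i. if i < Suc j then serve I x r v i else x v i) s \<and>
      fst s 4 0 = t \<and> fst s 5 0 = r * l \<and> fst s 7 0 = j \<and> snd s 2 0 = raise_level I x r)"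
proof -
  define z where "z = raised I x r j"
  define f where "f = (capacity I j - z) / (load I x r j - z)"
  define col where "col v = (if v = r then z else x v j)" for v
  \<comment> \<open>A hybrid configuration: classes below \<open>j\<close> are served, those above
    are untouched, and column \<open>j\<close> holds the intermediate values
    \<open>c\<close>.\<close>
  define St where "St c = (\<lambda>v i. if i < j then serve I x r v i else if i = j then c v else x v i)"
    for c :: "nat \<Rightarrow> real"
  define Inv where "Inv c s \<longleftrightarrow> keeps_input I \<sigma> s \<and> stores I (St c) s \<and> fst s 4 0 = t \<and>
    fst s 5 0 = r * l \<and> fst s 7 0 = j \<and> snd s 2 0 = raise_level I x r \<and> snd s 4 0 = z" for c s
  have St_write: "stores I (St (c(v := y))) (m', upd g (Suc 0) (v * l + j) y)"
    if "stores I (St c) (m, g)" for c v y m m' g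
    by (rule stores_write[OF that]) (use j in \<open>auto simp: St_def l_def\<close>)
  have read: "snd s (Suc 0) (v * l + j) = c v" if "Inv c s" "v < n" for c s v
    using that j stores_D[of I "St c" s v j] by (simp add: Inv_def St_def n_def l_def)
  have cap: "rval capacity_exp s = capacity I j" if "Inv c s" for c s
    using that j by (simp add: Inv_def capacity_exp_def capacity_def input_simps l_def)
  have load_eq: "load I x r j = (\<Sum>v<n. col v)"
    unfolding load_def col_def z_def n_def ..
  define fin where "fin s \<longleftrightarrow> keeps_input I \<sigma> s \<and>
    stores I (\<lambda>v i. if i < Suc j then serve I x r v i else x v i) s \<and>
    fst s 4 0 = t \<and> fst s 5 0 = r * l \<and> fst s 7 0 = j \<and> snd s 2 0 = raise_level I x r" for s
  have finI: "fin s" if "Inv c s" "\<And>v. c v = serve I x r v j" for c s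
    using that unfolding fin_def Inv_def
    by (auto elim!: stores_cong simp: St_def less_Suc_eq)

  have total: "halts_within (column_program (RSet 3 (RAdd (RVar 3) (RCell 1 (NVar 8)))))
      (n * 4 + 3) s (\<lambda>s. Inv col s \<and> snd s 3 0 = load I x r j)"
    if "Inv col s" "snd s 3 0 = 0" for s
    unfolding load_eq
    apply (rule column_program_halts[where j = j and
          P = "\<lambda>u s. Inv col s \<and> snd s 3 0 = (\<Sum>v<u. col v)"])
    subgoal using that by simp
    subgoal by (rule j)
    subgoal by (simp add: Inv_def)
    subgoal by (auto simp: Inv_def)
    subgoal for u s using read[of col s u]
      by (intro halts_within_RAssign) (simp add: Inv_def)
    done

  \<comment> \<open>Column \<open>j\<close> after the scaling loop has passed the first
    \<open>u\<close> points. At \<open>r\<close> this temporarily differs from the intended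
    result.\<close>
  define scaled where "scaled u v = (if v < u then col v * f else col v)" for u v
  have scale: "halts_within (column_program (RAssign 1 (NVar 8) (RMul (RCell 1 (NVar 8)) (RVar 5))))
      (n * 4 + 3) s (Inv (scaled n))"
    if "Inv col s" "snd s 5 0 = f" for s
    apply (rule halts_within_mono[OF column_program_halts[where j = j and
            P = "\<lambda>u s. Inv (scaled u) s \<and> snd s 5 0 = f"] order_refl])
    subgoal using that by (simp add: scaled_def[abs_def])
    subgoal by (rule j)
    subgoal by (simp add: Inv_def)
    subgoal by (auto simp: Inv_def)
    subgoal for u s
    proof -
      assume *: "Inv (scaled u) s \<and> snd s 5 0 = f" "u < n" "fst s 8 0 = u * l + j"
      have "scaled (Suc u) = (scaled u)(u := col u * f)"
        by (auto simp: scaled_def less_Suc_eq)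
      then show ?thesis
        using * read[of "scaled u" s u] St_write[of "scaled u" "fst s" "snd s" u "col u * f" "fst s"]
        by (intro halts_within_RAssign) (simp add: Inv_def scaled_def)
    qed
    subgoal by simp
    done

  have rest: "halts_within
      (Cond (RLess capacity_exp (RVar 3))
        (Seq (RSet 5 (RDiv (RSub capacity_exp (RVar 4)) (RSub (RVar 3) (RVar 4))))
        (Seq (column_program (RAssign 1 (NVar 8) (RMul (RCell 1 (NVar 8)) (RVar 5))))
             (RAssign 1 (NAdd (NVar 5) (NVar 7)) (RVar 4))))
        Skip) ((1 + ((n * 4 + 3) + 1)) + 1 + 1) s fin"
    if s: "Inv col s" "snd s 3 0 = load I x r j" for s
  proof (rule halts_within_Cond)
    assume "bval (RLess capacity_exp (RVar 3)) s"
    then have over: "capacity I j < load I x r j"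
      using s cap by simp
    \<comment> \<open>Away from \<open>r\<close> the scaled column already agrees with
      \<open>serve\<close>; the last write puts \<open>z\<close> back at \<open>r\<close>.\<close>
    have final: "fin (m, upd g (Suc 0) (r * l + j) z)" if "Inv (scaled n) (m, g)" for m g
    proof -
      have "stores I (\<lambda>v i. if i < Suc j then serve I x r v i else x v i)
          (m, upd g (Suc 0) (r * l + j) z)"
        apply (rule stores_cong[OF St_write[of "scaled n" m g]])
        subgoal using that by (simp add: Inv_def)
        subgoal using over
          by (auto simp: St_def scaled_def col_def serve_def f_def z_def n_def less_Suc_eq)
        done
      then show ?thesis
        using that by (simp add: fin_def Inv_def)
    qed
    show "halts_within
        (Seq (RSet 5 (RDiv (RSub capacity_exp (RVar 4)) (RSub (RVar 3) (RVar 4))))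
        (Seq (column_program (RAssign 1 (NVar 8) (RMul (RCell 1 (NVar 8)) (RVar 5))))
             (RAssign 1 (NAdd (NVar 5) (NVar 7)) (RVar 4)))) (1 + ((n * 4 + 3) + 1)) s fin"
      apply (rule halts_within_Seq, rule halts_within_RAssign, rule halts_within_Seq)
      apply (rule halts_within_mono[OF scale order_refl])
      subgoal using s by (simp add: Inv_def)
      subgoal using s cap[OF s(1)] by (simp add: Inv_def f_def)
      subgoal for s' using final[of "fst s'" "snd s'"]
        by (intro halts_within_RAssign) (simp add: Inv_def)
      done
  next
    assume "\<not> bval (RLess capacity_exp (RVar 3)) s"
    then have "\<not> capacity I j < load I x r j"
      using s cap by simp
    then have "col v = serve I x r v j" for v
      by (simp add: col_def z_def serve_def)
    then show "halts_within Skip 1 s fin"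
      using s finI by (intro halts_within_Skip) auto
  qed
  have start: "stores I (St col) (m', upd g (Suc 0) (r * l + j) z)"
    if "stores I (\<lambda>v i. if i < j then serve I x r v i else x v i) (m, g)" for m m' g
    by (rule stores_write[OF that]) (use j in \<open>auto simp: St_def col_def l_def\<close>)
  have z: "snd s (Suc 0) (r * l + j) + raise_level I x r / snd s 0 j = z"
    using s r j stores_D[OF s(2), of r j]
    by (simp add: z_def raised_def input_simps n_def l_def)
  have "halts_within class_program
      (1 + (1 + (1 + ((n * 4 + 3) + ((1 + ((n * 4 + 3) + 1)) + 1 + 1))))) s fin"
    unfolding class_program_def
    apply (rule halts_within_Seq, rule halts_within_RAssign)
    apply (rule halts_within_Seq, rule halts_within_RAssign)
    apply (rule halts_within_Seq, rule halts_within_RAssign, rule halts_within_Seq)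
    apply (rule halts_within_mono[OF total order_refl])
    subgoal using s z start[of "fst s" "upd (snd s) 4 0 z"] by (simp add: Inv_def)
    subgoal by simp
    subgoal using rest by simp
    done
  then have "halts_within class_program (n * 8 + 14) s fin"
    by (rule halts_within_le) simp
  then show ?thesis
    by (simp add: fin_def[abs_def])
qed

lemma serve_program_halts:
  assumes "keeps_input I \<sigma> s" "stores I x s" "fst s 4 0 = t" "t < length \<sigma>"
  shows "halts_within serve_program (n * 3 + l * 5 + l * (n * 8 + 16) + 11) s
    (\<lambda>s. keeps_input I \<sigma> s \<and> stores I (serve I x (\<sigma> ! t)) s \<and> fst s 4 0 = t)"
proof -
  let ?r = "\<sigma> ! t"
  have r: "?r < n"
    using valid_requests_nth[OF req assms(4)] by (simp add: n_def)
  define Inv where "Inv j s \<longleftrightarrow> keeps_input I \<sigma> s \<and>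
    stores I (\<lambda>v i. if i < j then serve I x ?r v i else x v i) s \<and>
    fst s 4 0 = t \<and> fst s 5 0 = ?r * l \<and> fst s 7 0 = j \<and> snd s 2 0 = raise_level I x ?r" for j s
  have "halts_within serve_program
      ((n * 3 + 3) + ((l * 5 + 6) + (l * ((n * 8 + 14) + 2) + 2))) s
    (\<lambda>s. keeps_input I \<sigma> s \<and> stores I (serve I x ?r) s \<and> fst s 4 0 = t)"
    unfolding serve_program_def
    apply (rule halts_within_Seq)
    apply (rule halts_within_mono[OF row_program_halts[OF assms] order_refl])
    apply (rule halts_within_Seq)
    subgoal for s1
      apply (rule halts_within_mono[OF level_program_halts[of s1 x t ?r] order_refl])
      subgoal by simp
      subgoal by simp
      subgoal by simp
      subgoal by simp
      subgoal by (rule r)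
      subgoal for s2
        apply (rule halts_within_For[where P = Inv])
        subgoal by (simp add: Inv_def)
        subgoal by (simp add: Inv_def)
        subgoal by (simp add: Inv_def input_simps l_def)
        subgoal for j s3
          by (rule halts_within_mono[OF class_program_halts[of s3 j x ?r t] order_refl])
            (auto simp: Inv_def r)
        subgoal by (auto simp: Inv_def l_def elim!: stores_cong)
        done
      done
    done
  then show ?thesis
    by (rule halts_within_le) simp
qed

lemma main_program_halts:
  assumes "keeps_input I \<sigma> s"
  shows "halts_within main_program
    (n * (l * 4 + 4) + length \<sigma> * (n * 3 + l * 5 + l * (n * 8 + 16) + 13) + 5) s
    (stores I (serve_all I \<sigma>))"
proof -
  have "halts_within main_program
    ((n * (l * 4 + 4) + 3) + (length \<sigma> * ((n * 3 + l * 5 + l * (n * 8 + 16) + 11) + 2) + 2)) s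
    (stores I (serve_all I \<sigma>))"
    unfolding main_program_def
    apply (rule halts_within_Seq)
    apply (rule halts_within_mono[OF load_program_halts[OF assms] order_refl])
    apply (rule halts_within_For[where P = "\<lambda>t s. keeps_input I \<sigma> s \<and>
          stores I (serve_all I (take t \<sigma>)) s \<and> fst s 4 0 = t"])
    subgoal by (simp add: serve_all_def)
    subgoal by simp
    subgoal by (simp add: input_simps)
    subgoal for _ t s
      by (rule halts_within_mono[OF serve_program_halts[of s "serve_all I (take t \<sigma>)" t] order_refl])
        (auto simp: serve_all_def take_Suc_conv_app_nth)
    subgoal by simp
    done
  then show ?thesis
    by (rule halts_within_le) simp
qed

end

section \<open>Running time\<close>

lemma polynomial_time_serve_all: "polynomial_time serve_all"
  unfolding polynomial_time_def
\<comment> \<open>The definition uses one number \<open>d\<close> both as coefficient and as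
  exponent. The time is at most \<open>8 * S ^ 3 + 28 * S ^ 2 + 17 * S + 5\<close>, and 58 is the
  sum of these coefficients, generous as an exponent.\<close>
proof (rule exI[of _ main_program], rule exI[of _ 58], intro allI impI)
  fix I \<sigma> assume valid: "valid_instance I" and req: "valid_requests I \<sigma>"
  let ?n = "num_points I" and ?l = "num_weights I" and ?T = "length \<sigma>"
  define S where "S = ?n + ?l + ?T"
  have S: "?n \<le> S" "?l \<le> S" "?T \<le> S" "1 \<le> S"
    using valid by (auto simp: S_def valid_instance_def)
  have "keeps_input I \<sigma> (input_state I \<sigma>)"
    by (simp add: keeps_input_def)
  from main_program_halts[OF valid req this] obtain t s where
    run: "runs main_program (input_state I \<sigma>) t s" "stores I (serve_all I \<sigma>) s" and
    t: "t \<le> ?n * (?l * 4 + 4) + ?T * (?n * 3 + ?l * 5 + ?l * (?n * 8 + 16) + 13) + 5"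
    by (auto simp: halts_within_def)
  note t
  also have "?n * (?l * 4 + 4) + ?T * (?n * 3 + ?l * 5 + ?l * (?n * 8 + 16) + 13) + 5 \<le>
      S * (S * 4 + 4) + S * (S * 3 + S * 5 + S * (S * 8 + 16) + 13) + 5"
    using S by (intro add_mono mult_le_mono order_refl)
  also have "\<dots> = 8 * S ^ 3 + 28 * S ^ 2 + 17 * S ^ 1 + 5 * S ^ 0"
    by (simp add: power2_eq_square power3_eq_cube algebra_simps)
  also have "\<dots> \<le> 8 * S ^ 58 + 28 * S ^ 58 + 17 * S ^ 58 + 5 * S ^ 58"
    using S(4) by (intro add_mono mult_le_mono order_refl power_increasing) auto
  finally have "t \<le> 58 * S ^ 58"
    by simp
  then show "\<exists>t s. runs main_program (input_state I \<sigma>) t s \<and>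
      t \<le> 58 * (?n + ?l + ?T) ^ 58 \<and>
      (\<forall>v<?n. \<forall>j<?l. serve_all I \<sigma> v j = ram_output I s v j)"
    using run unfolding S_def stores_def by (intro exI[of _ t] exI[of _ s]) simp
qed

text \<open>From \<open>l = 3\<close> on, \<open>ln l \<ge> 1\<close> because
  \<open>exp 1 \<le> 3\<close>. The bound can only hold eventually, as the right-hand side vanishes
  at \<open>l = 1\<close>.\<close>

lemma linear_bigo_square_ln:
  "(\<lambda>l. 6 * real l) \<in> O(\<lambda>l. (real l)\<^sup>2 * ln (real l))"
proof (rule bigoI[of _ 6])
  have "norm (6 * real l) \<le> 6 * norm ((real l)\<^sup>2 * ln (real l))" if "3 \<le> l" for l
  proof -
    have "1 \<le> ln (real l)"
      using that exp_le by (simp add: ln_ge_iff)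
    moreover have "real l * 1 \<le> real l * real l"
      using that by (intro mult_left_mono) auto
    ultimately have "real l * 1 \<le> (real l)\<^sup>2 * ln (real l)"
      unfolding power2_eq_square by (intro mult_mono) auto
    then show ?thesis
      by simp
  qed
  then show "\<forall>\<^sub>F l in sequentially. norm (6 * real l) \<le> 6 * norm ((real l)\<^sup>2 * ln (real l))"
    unfolding eventually_sequentially by blast
qed

theorem theorem5p1:
  shows "\<exists>(A :: online_alg) (\<rho> :: nat \<Rightarrow> real).
    polynomial_time A \<and>
    \<rho> \<in> O(\<lambda>l. (real l)\<^sup>2 * ln (real l)) \<and>
    (\<forall>I \<sigma>. valid_instance I \<longrightarrow> valid_requests I \<sigma> \<longrightarrow>
       fractional_solution I (\<lambda>j. 2 * num_weights I * servers I j) (length \<sigma>) (trajectory A I \<sigma>) \<and>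
       single_weight_service I \<sigma> (trajectory A I \<sigma>) \<and>
       movement_cost I (length \<sigma>) (trajectory A I \<sigma>) \<le> \<rho> (num_weights I) * lp_opt I \<sigma>)"
proof (intro exI[of _ serve_all] exI[of _ "\<lambda>l. 6 * real l"] conjI allI impI)
  show "polynomial_time serve_all"
    by (rule polynomial_time_serve_all)
  show "(\<lambda>l. 6 * real l) \<in> O(\<lambda>l. (real l)\<^sup>2 * ln (real l))"
    by (rule linear_bigo_square_ln)
qed (simp_all add: trajectory_fractional_solution trajectory_single_weight_service
    trajectory_competitive)

end
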